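(* Let $E$ be a Banach space. Then $E$ has the Schur property if and only if $E$ (with the norm topology) and $E_w$ are sequentially homeomorphic.
   Context: Banach spaces are real. $E_w$ denotes $E$ endowed with its weak topology $\sigma(E,E^* )$. $E$ has the Schur property if every weakly convergent sequence in $E$ is norm convergent. Two topological spaces $X$ and $Y$ are sequentially homeomorphic if there exists a sequentially continuous bijection $f\colon X\to Y$ (not required to be linear) whose inverse $f^{-1}$ is also sequentially continuous. *)

theory Defs
  imports "HOL-Analysis.Analysis"
begin

text \<open>The weak topology: the initial topology on the space for the family of all continuous
  linear functionals.\<close>

definition weak_topology :: "'a::real_normed_vector topology" where
  "weak_topology =
     topology_generated_by {blinfun_apply \<phi> -` U | (\<phi> :: 'a \<Rightarrow>\<^sub>L real) U. open U}"

lemma topspace_weak_topology [simp]: "topspace weak_topology = UNIV"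
  unfolding weak_topology_def topology_generated_by_topspace
  by (auto intro!: exI[of _ UNIV])

lemma openin_weak_topology_vimage:
  fixes \<phi> :: "'a::real_normed_vector \<Rightarrow>\<^sub>L real"
  assumes "open U"
  shows "openin weak_topology (blinfun_apply \<phi> -` U)"
  unfolding weak_topology_def using assms by (intro topology_generated_by_Basis) auto

definition schur_property :: "'a::real_normed_vector itself \<Rightarrow> bool" where
  "schur_property _ \<longleftrightarrow>
     (\<forall>x :: nat \<Rightarrow> 'a. (\<exists>l. limitin weak_topology x l sequentially) \<longrightarrow> convergent x)"

text \<open>The range condition below is needed because \<^const>\<open>limitin\<close> only forces the terms of a
  sequence to lie in the space eventually.\<close>

definition seq_continuous_map :: "'a topology \<Rightarrow> 'b topology \<Rightarrow> ('a \<Rightarrow> 'b) \<Rightarrow> bool" where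
  "seq_continuous_map X Y f \<longleftrightarrow>
     f \<in> topspace X \<rightarrow> topspace Y \<and>
     (\<forall>x l. range x \<subseteq> topspace X \<and> limitin X x l sequentially
        \<longrightarrow> limitin Y (f \<circ> x) (f l) sequentially)"

definition seq_homeomorphic_spaces :: "'a topology \<Rightarrow> 'b topology \<Rightarrow> bool" where
  "seq_homeomorphic_spaces X Y \<longleftrightarrow>
     (\<exists>f. bij_betw f (topspace X) (topspace Y) \<and>
          seq_continuous_map X Y f \<and>
          seq_continuous_map Y X (inv_into (topspace X) f))"

end

theory Submission
  imports Defs
begin

text \<open>
  If \<open>E\<close> has the Schur property, then weakly convergent sequences converge in norm to their weak
  limit, so the identity is a sequential homeomorphism.

  For the converse, the invariant that tells the two topologies apart is a diagonal property
  (\<open>weak_diagonal_sequence\<close>). In a metric space, given countably many sequences with the same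
  limit, one term can be picked from each sequence so that the picked terms converge to this limit
  as well. A sequential homeomorphism carries this property over to the weak topology. Suppose
  that \<open>y\<^sub>k\<close> is weakly null and \<open>norm y\<^sub>k \<ge> \<epsilon> > 0\<close> for infinitely many \<open>k\<close>. For every \<open>n\<close> the
  sequence \<open>k \<mapsto> n y\<^sub>k\<close> is weakly null too, so a choice of indices \<open>k\<^sub>n\<close> makes
  \<open>n y\<^bsub>k\<^sub>n\<^esub>\<close> weakly null while \<open>norm (n y\<^bsub>k\<^sub>n\<^esub>) \<ge> n \<epsilon>\<close>. But a weakly convergent sequence is
  bounded.

  The boundedness of weakly convergent sequences (\<open>limitin_weak_topology_imp_Bseq\<close>) comes from two
  classical facts: Baire's theorem in the dual space and
  the theorem of Hahn and Banach, in the form that each vector \<open>x\<close> has a functional of norm at most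
  1 that takes the value \<open>norm x\<close> at \<open>x\<close> (\<open>norming_functional\<close>).
\<close>

section \<open>Sequences in the weak topology\<close>

text \<open>The sets that contain the limit only if they contain almost all terms include the preimages
  that generate the topology, and they are stable under binary intersections and arbitrary
  unions.\<close>

lemma limitin_weak_topology_iff:
  fixes x :: "nat \<Rightarrow> 'a::real_normed_vector"
  shows "limitin weak_topology x l sequentially \<longleftrightarrow>
         (\<forall>\<phi> :: 'a \<Rightarrow>\<^sub>L real. (\<lambda>n. blinfun_apply \<phi> (x n)) \<longlonglongrightarrow> blinfun_apply \<phi> l)"
proof
  assume lim: "limitin weak_topology x l sequentially"
  show "\<forall>\<phi> :: 'a \<Rightarrow>\<^sub>L real. (\<lambda>n. blinfun_apply \<phi> (x n)) \<longlonglongrightarrow> blinfun_apply \<phi> l"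
  proof (intro allI topological_tendstoI)
    fix \<phi> :: "'a \<Rightarrow>\<^sub>L real" and U :: "real set"
    assume "open U" and "blinfun_apply \<phi> l \<in> U"
    then have "\<forall>\<^sub>F n in sequentially. x n \<in> blinfun_apply \<phi> -` U"
      using lim openin_weak_topology_vimage[of U \<phi>] unfolding limitin_def by blast
    then show "\<forall>\<^sub>F n in sequentially. blinfun_apply \<phi> (x n) \<in> U"
      by simp
  qed
next
  assume conv: "\<forall>\<phi> :: 'a \<Rightarrow>\<^sub>L real. (\<lambda>n. blinfun_apply \<phi> (x n)) \<longlonglongrightarrow> blinfun_apply \<phi> l"
  have ev: "\<forall>\<^sub>F n in sequentially. x n \<in> U"
    if "generate_topology_on {blinfun_apply \<phi> -` U | (\<phi> :: 'a \<Rightarrow>\<^sub>L real) U. open U} U" "l \<in> U" for U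
    using that
  proof (induction rule: generate_topology_on.induct)
    case Empty
    then show ?case by simp
  next
    case (Int a b)
    then show ?case by (auto intro: eventually_conj)
  next
    case (UN K)
    then obtain k where "k \<in> K" "l \<in> k" by blast
    with UN.IH[of k] have "\<forall>\<^sub>F n in sequentially. x n \<in> k" by blast
    then show ?case
      by (rule eventually_mono) (use \<open>k \<in> K\<close> in blast)
  next
    case (Basis s)
    then obtain \<phi> :: "'a \<Rightarrow>\<^sub>L real" and U
      where s: "s = blinfun_apply \<phi> -` U" "open U" by blast
    then have "\<forall>\<^sub>F n in sequentially. blinfun_apply \<phi> (x n) \<in> U"
      using conv Basis.prems topological_tendstoD by blast
    then show ?case using s by simp
  qed
  show "limitin weak_topology x l sequentially"
    unfolding limitin_def
    using ev by (auto simp: weak_topology_def openin_topology_generated_by_iff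
        topspace_weak_topology[unfolded weak_topology_def])
qed

lemma limitin_weak_topology_if_tendsto:
  fixes x :: "nat \<Rightarrow> 'a::real_normed_vector"
  assumes "x \<longlonglongrightarrow> l"
  shows "limitin weak_topology x l sequentially"
  unfolding limitin_weak_topology_iff by (auto intro!: tendsto_intros assms)

section \<open>A norming functional for every vector\<close>

text \<open>The norming functional is found as a minimal element among the sublinear functionals below a given
  one: minimality forces linearity, so no extension from subspaces is involved. Homogeneity is
  stated as an inequality, which is all that has to be checked for infima; equality follows by
  scaling back with \<open>1 / c\<close>.\<close>

definition sublinear :: "('a::real_vector \<Rightarrow> real) \<Rightarrow> bool" where
  "sublinear p \<longleftrightarrow>
     (\<forall>x y. p (x + y) \<le> p x + p y) \<and> (\<forall>c x. 0 \<le> c \<longrightarrow> p (c *\<^sub>R x) \<le> c * p x)"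

lemma sublinear_add: "sublinear p \<Longrightarrow> p (x + y) \<le> p x + p y"
  by (simp add: sublinear_def)

lemma sublinear_scaleR_le: "sublinear p \<Longrightarrow> 0 \<le> c \<Longrightarrow> p (c *\<^sub>R x) \<le> c * p x"
  by (simp add: sublinear_def)

lemma sublinear_zero:
  assumes "sublinear p"
  shows "p 0 = 0"
  using sublinear_add[OF assms, of 0 0] sublinear_scaleR_le[OF assms, of 0 0] by simp

lemma sublinear_scaleR:
  assumes "sublinear p" "0 \<le> c"
  shows "p (c *\<^sub>R x) = c * p x"
proof (cases "c = 0")
  case False
  then have "p (inverse c *\<^sub>R (c *\<^sub>R x)) \<le> inverse c * p (c *\<^sub>R x)"
    using assms by (intro sublinear_scaleR_le) auto
  with False \<open>0 \<le> c\<close> have "c * p x \<le> p (c *\<^sub>R x)"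
    by (simp add: field_simps)
  with sublinear_scaleR_le[OF assms] show ?thesis by (simp add: antisym)
qed (simp add: sublinear_zero[OF assms(1)])

lemma sublinear_minus_ge:
  assumes "sublinear p"
  shows "- p (- x) \<le> p x"
  using sublinear_add[OF assms, of x "- x"] sublinear_zero[OF assms] by simp

lemma sublinear_norm: "sublinear norm"
  by (simp add: sublinear_def norm_triangle_ineq)

text \<open>This is the largest sublinear functional below \<open>q\<close> whose value at \<open>- y\<close> is at most \<open>- q y\<close>.
  It serves twice: comparing a minimal \<open>q\<close> with its tilts gives additivity, and starting from
  the tilt of the norm in direction \<open>x\<close> forces the value \<open>norm x\<close> at \<open>x\<close>.\<close>

definition tilt :: "('a::real_vector \<Rightarrow> real) \<Rightarrow> 'a \<Rightarrow> 'a \<Rightarrow> real" where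
  "tilt q y x = (INF t\<in>{0..}. q (x + t *\<^sub>R y) - t * q y)"

lemma tilt_le:
  assumes "sublinear q" "0 \<le> t"
  shows "tilt q y x \<le> q (x + t *\<^sub>R y) - t * q y"
  unfolding tilt_def
proof (rule cINF_lower)
  have "- q (- x) \<le> q (x + t *\<^sub>R y) - t * q y" if "0 \<le> t" for t
    using sublinear_add[OF assms(1), of "- x" "x + t *\<^sub>R y"] sublinear_scaleR[OF assms(1) that, of y]
    by simp
  then show "bdd_below ((\<lambda>t. q (x + t *\<^sub>R y) - t * q y) ` {0..})"
    by (auto intro!: bdd_belowI[where m = "- q (- x)"])
qed (use assms in auto)

lemma tilt_greatest:
  assumes "\<And>t. 0 \<le> t \<Longrightarrow> b \<le> q (x + t *\<^sub>R y) - t * q y"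
  shows "b \<le> tilt q y x"
  unfolding tilt_def using assms by (intro cINF_greatest) auto

lemma tilt_le_self:
  assumes "sublinear q"
  shows "tilt q y \<le> q"
  using tilt_le[OF assms, of 0 y] by (auto simp: le_fun_def)

text \<open>The parameters over which the infimum is taken add up when arguments are added and scale
  with the argument, so sublinearity of \<open>q\<close> passes to the infimum.\<close>

lemma sublinear_tilt:
  assumes q: "sublinear q"
  shows "sublinear (tilt q y)"
  unfolding sublinear_def
proof (intro conjI allI impI)
  fix x x'
  have *: "tilt q y (x + x') \<le> (q (x + s *\<^sub>R y) - s * q y) + (q (x' + t *\<^sub>R y) - t * q y)"
    if "0 \<le> s" "0 \<le> t" for s t
    using tilt_le[OF q, of "s + t" y "x + x'"] that
      sublinear_add[OF q, of "x + s *\<^sub>R y" "x' + t *\<^sub>R y"]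
    by (simp add: algebra_simps)
  have "tilt q y (x + x') - (q (x' + t *\<^sub>R y) - t * q y) \<le> tilt q y x" if "0 \<le> t" for t
    by (rule tilt_greatest) (use * that in \<open>simp add: algebra_simps\<close>)
  then have "tilt q y (x + x') - tilt q y x \<le> tilt q y x'"
    by (intro tilt_greatest) (simp add: algebra_simps)
  then show "tilt q y (x + x') \<le> tilt q y x + tilt q y x'" by simp
next
  fix c :: real and x
  assume "0 \<le> c"
  show "tilt q y (c *\<^sub>R x) \<le> c * tilt q y x"
  proof (cases "c = 0")
    case True
    then show ?thesis
      using tilt_le[OF q, of 0 y 0] by (simp add: sublinear_zero[OF q])
  next
    case False
    with \<open>0 \<le> c\<close> have "0 < c" by simp
    have "tilt q y (c *\<^sub>R x) / c \<le> tilt q y x"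
    proof (rule tilt_greatest)
      fix t :: real
      assume "0 \<le> t"
      then have "tilt q y (c *\<^sub>R x) \<le> q (c *\<^sub>R (x + t *\<^sub>R y)) - (c * t) * q y"
        using tilt_le[OF q, of "c * t" y "c *\<^sub>R x"] \<open>0 < c\<close> by (simp add: scaleR_add_right)
      also have "\<dots> = c * (q (x + t *\<^sub>R y) - t * q y)"
        unfolding sublinear_scaleR[OF q \<open>0 \<le> c\<close>] by (simp add: right_diff_distrib)
      finally show "tilt q y (c *\<^sub>R x) / c \<le> q (x + t *\<^sub>R y) - t * q y"
        using \<open>0 < c\<close> by (simp add: field_simps)
    qed
    with \<open>0 < c\<close> show ?thesis by (simp add: field_simps)
  qed
qed

text \<open>By minimality \<open>q\<close> agrees with its tilt in direction \<open>y\<close>; the term with \<open>t = 1\<close> in the infimum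
  then says \<open>q x \<le> q (x + y) - q y\<close>, the converse of subadditivity.\<close>

lemma minimal_sublinear_is_linear:
  fixes q :: "'a::real_vector \<Rightarrow> real"
  assumes q: "sublinear q"
    and minimal: "\<And>r. sublinear r \<Longrightarrow> r \<le> q \<Longrightarrow> r = q"
  shows "linear q"
proof -
  have add: "q (x + y) = q x + q y" for x y
  proof (rule antisym)
    have "tilt q y = q"
      by (rule minimal[OF sublinear_tilt[OF q] tilt_le_self[OF q]])
    with tilt_le[OF q, of 1 y x] show "q x + q y \<le> q (x + y)" by simp
  qed (rule sublinear_add[OF q])
  have neg: "q (- x) = - q x" for x
    using add[of x "- x"] sublinear_zero[OF q] by simp
  have "q (c *\<^sub>R x) = c * q x" for c x
    using sublinear_scaleR[OF q, of c x] sublinear_scaleR[OF q, of "- c" x] neg[of "c *\<^sub>R x"]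
    by (cases "0 \<le> c") auto
  with add show ?thesis by (intro linearI) auto
qed

text \<open>The bound is the pointwise infimum. It is finite because \<open>q x \<ge> - q (- x) \<ge> - p (- x)\<close> for all
  \<open>q\<close> in the chain, and it is subadditive because two members of the chain can be replaced by the
  smaller one.\<close>

lemma sublinear_chain_lower_bound:
  fixes p :: "'a::real_vector \<Rightarrow> real"
  assumes C: "\<And>q. q \<in> C \<Longrightarrow> sublinear q \<and> q \<le> p" and "C \<noteq> {}"
    and total: "\<And>q r. q \<in> C \<Longrightarrow> r \<in> C \<Longrightarrow> q \<le> r \<or> r \<le> q"
  obtains m where "sublinear m" "\<And>q. q \<in> C \<Longrightarrow> m \<le> q"
proof
  define m where "m x = (INF q\<in>C. q x)" for x
  have lower: "m x \<le> q x" if "q \<in> C" for q x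
    unfolding m_def
  proof (rule cINF_lower)
    have "- p (- x) \<le> q x" if "q \<in> C" for q
      using C[OF that] sublinear_minus_ge[of q x] by (auto simp: le_fun_def dest!: spec[of _ "- x"])
    then show "bdd_below ((\<lambda>q. q x) ` C)"
      by (auto intro!: bdd_belowI[where m = "- p (- x)"])
  qed (rule that)
  have greatest: "b \<le> m x" if "\<And>q. q \<in> C \<Longrightarrow> b \<le> q x" for b x
    unfolding m_def using \<open>C \<noteq> {}\<close> that by (intro cINF_greatest)
  show "m \<le> q" if "q \<in> C" for q
    using lower[OF that] by (simp add: le_fun_def)
  show "sublinear m"
    unfolding sublinear_def
  proof (intro conjI allI impI)
    fix x y
    have *: "m (x + y) \<le> q x + r y" if qr: "q \<in> C" "r \<in> C" for q r
    proof -
      obtain s where s: "s \<in> C" "s \<le> q" "s \<le> r"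
        using total[OF qr] qr by blast
      have "m (x + y) \<le> s (x + y)" by (rule lower[OF s(1)])
      also have "\<dots> \<le> s x + s y" using C[OF s(1)] sublinear_add by blast
      also have "\<dots> \<le> q x + r y" using s by (intro add_mono) (auto simp: le_fun_def)
      finally show ?thesis .
    qed
    have "m (x + y) - r y \<le> m x" if "r \<in> C" for r
      by (rule greatest) (use * that in \<open>simp add: algebra_simps\<close>)
    then have "m (x + y) - m x \<le> m y"
      by (intro greatest) (simp add: algebra_simps)
    then show "m (x + y) \<le> m x + m y" by simp
  next
    fix c :: real and x
    assume "0 \<le> c"
    show "m (c *\<^sub>R x) \<le> c * m x"
    proof (cases "c = 0")
      case True
      obtain q where "q \<in> C" using \<open>C \<noteq> {}\<close> by blast
      then have "m 0 \<le> 0" using lower[of q 0] C[of q] sublinear_zero[of q] by simp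
      with True show ?thesis by simp
    next
      case False
      with \<open>0 \<le> c\<close> have "0 < c" by simp
      have "m (c *\<^sub>R x) / c \<le> m x"
      proof (rule greatest)
        fix q assume "q \<in> C"
        then have "m (c *\<^sub>R x) \<le> c * q x"
          using lower[of q "c *\<^sub>R x"] C[of q] sublinear_scaleR[of q c x] \<open>0 \<le> c\<close> by simp
        with \<open>0 < c\<close> show "m (c *\<^sub>R x) / c \<le> q x" by (simp add: field_simps)
      qed
      with \<open>0 < c\<close> show ?thesis by (simp add: field_simps)
    qed
  qed
qed

lemma linear_below_sublinear:
  fixes p :: "'a::real_vector \<Rightarrow> real"
  assumes p: "sublinear p"
  obtains f where "linear f" "f \<le> p"
proof -
  define A where "A = {q. sublinear q \<and> q \<le> p}"
  have "\<exists>m\<in>A. \<forall>q\<in>A. q \<le> m \<longrightarrow> q = m"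
  proof (rule predicate_Zorn[where P = "\<lambda>q r. r \<le> q"])
    show "partial_order_on A (relation_of (\<lambda>q r. r \<le> q) A)"
      by (rule partial_order_on_relation_ofI) auto
  next
    fix C assume chain: "C \<in> Chains (relation_of (\<lambda>q r. r \<le> q) A)"
    show "\<exists>u\<in>A. \<forall>a\<in>C. u \<le> a"
    proof (cases "C = {}")
      case True
      with p show ?thesis by (auto simp: A_def)
    next
      case False
      have sub: "C \<subseteq> A" by (rule Chains_relation_of[OF chain])
      have total: "q \<le> r \<or> r \<le> q" if "q \<in> C" "r \<in> C" for q r
        using chain that unfolding Chains_def relation_of_def by auto
      obtain m where m: "sublinear m" "\<And>q. q \<in> C \<Longrightarrow> m \<le> q"
        using sublinear_chain_lower_bound[of C p] False sub total unfolding A_def by blast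
      obtain q where "q \<in> C" using False by blast
      with sub m(2) have "m \<le> p" unfolding A_def using order_trans by blast
      with m show ?thesis unfolding A_def by blast
    qed
  qed
  then obtain m where m: "sublinear m" "m \<le> p"
    and minimal: "\<And>q. sublinear q \<Longrightarrow> q \<le> p \<Longrightarrow> q \<le> m \<Longrightarrow> q = m"
    unfolding A_def by blast
  have "linear m"
    by (rule minimal_sublinear_is_linear[OF m(1)]) (use minimal m(2) order_trans in blast)
  with m(2) show ?thesis by (rule that[rotated])
qed

text \<open>A linear \<open>f\<close> below the tilt of the norm is below the norm, hence of norm at most 1, and it
  satisfies \<open>f (- x) \<le> norm (- x + x) - norm x = - norm x\<close>.\<close>

lemma norming_functional:
  fixes x :: "'a::real_normed_vector"
  obtains \<phi> :: "'a \<Rightarrow>\<^sub>L real" where "norm \<phi> \<le> 1" "blinfun_apply \<phi> x = norm x"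
proof -
  obtain f where "linear f" and f_le: "f \<le> tilt norm x"
    using linear_below_sublinear[OF sublinear_tilt[OF sublinear_norm, of x]] by blast
  interpret linear f by fact
  have f_le_norm: "f z \<le> norm z" for z
    using f_le tilt_le_self[OF sublinear_norm, of x] by (meson le_funD order_trans)
  have abs_f: "\<bar>f z\<bar> \<le> norm z" for z
    using f_le_norm[of z] f_le_norm[of "- z"] by (simp add: neg abs_le_iff)
  have "bounded_linear f"
    by (rule bounded_linear_intro[where K = 1]) (use abs_f in \<open>auto simp: add scale\<close>)
  then have apply_f: "blinfun_apply (Blinfun f) = f" by (rule bounded_linear_Blinfun_apply)
  have "f (- x) \<le> - norm x"
    using le_funD[OF f_le, of "- x"] tilt_le[OF sublinear_norm, of 1 x "- x"] by simp
  then have "f x = norm x" using f_le_norm[of x] by (simp add: neg)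
  moreover have "norm (Blinfun f) \<le> 1"
    by (rule norm_blinfun_bound) (use abs_f in \<open>auto simp: apply_f\<close>)
  ultimately show ?thesis using that apply_f by metis
qed

section \<open>Weakly convergent sequences are bounded\<close>

text \<open>This is the uniform boundedness principle for the vectors \<open>x n\<close>, viewed as functionals on the
  dual space. The closed sets \<open>A m\<close> of functionals bounded by \<open>m\<close> along the sequence cover the dual,
  so by Baire's theorem one of them contains a ball. The difference of its centre \<open>\<psi>\<close> and
  \<open>\<psi> + r \<phi>\<close>, where \<open>\<phi>\<close> norms \<open>x n\<close>, shows \<open>r norm (x n) \<le> 2 m\<close>.\<close>

lemma pointwise_bounded_functionals_bounded:
  fixes x :: "nat \<Rightarrow> 'a::real_normed_vector"
  assumes "\<And>\<phi> :: 'a \<Rightarrow>\<^sub>L real. Bseq (\<lambda>n. blinfun_apply \<phi> (x n))"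
  shows "Bseq x"
proof -
  define A :: "nat \<Rightarrow> ('a \<Rightarrow>\<^sub>L real) set"
    where "A m = {\<phi>. \<forall>n. \<bar>blinfun_apply \<phi> (x n)\<bar> \<le> real m}" for m
  have closed_A: "closed (A m)" for m
  proof -
    have "A m = (\<Inter>n. {\<phi>. \<bar>blinfun_apply \<phi> (x n)\<bar> \<le> real m})"
      by (auto simp: A_def)
    moreover have "closed {\<phi>. \<bar>blinfun_apply \<phi> (x n)\<bar> \<le> real m}" for n
      by (intro closed_Collect_le continuous_intros)
    ultimately show ?thesis by auto
  qed
  have cover: "\<exists>m. \<phi> \<in> A m" for \<phi>
  proof -
    obtain K where "\<And>n. norm (blinfun_apply \<phi> (x n)) \<le> K"
      using assms[of \<phi>] by (meson BseqE)
    moreover obtain m where "K \<le> real m" using real_arch_simple by blast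
    ultimately have "\<bar>blinfun_apply \<phi> (x n)\<bar> \<le> real m" for n
      by (metis order_trans real_norm_def)
    then show ?thesis unfolding A_def by blast
  qed
  have "\<exists>m. interior (A m) \<noteq> {}"
  proof (rule ccontr)
    assume "\<not> ?thesis"
    then have "Met_TC.mtopology interior_of \<Union>(range A) = {}"
      using closed_A by (intro Met_TC.metric_Baire_category_alt) (auto simp: mcomplete_iff_complete complete_UNIV)
    moreover have "\<Union>(range A) = UNIV"
      using cover by auto
    ultimately show False by simp
  qed
  then obtain m \<psi> where "\<psi> \<in> interior (A m)" by blast
  then obtain r where r: "0 < r" "cball \<psi> r \<subseteq> A m"
    by (auto simp: mem_interior_cball)
  have "norm (x n) \<le> 2 * real m / r" for n
  proof -
    obtain \<phi> :: "'a \<Rightarrow>\<^sub>L real" where \<phi>: "norm \<phi> \<le> 1" "blinfun_apply \<phi> (x n) = norm (x n)"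
      by (rule norming_functional)
    have "\<psi> \<in> A m" "\<psi> + r *\<^sub>R \<phi> \<in> A m"
      using r \<phi>(1) by (auto simp: dist_norm subset_iff mult_left_le)
    then have "\<bar>blinfun_apply \<psi> (x n)\<bar> \<le> real m"
      "\<bar>blinfun_apply \<psi> (x n) + r * norm (x n)\<bar> \<le> real m"
      unfolding A_def by (auto simp: blinfun.bilinear_simps \<phi>(2) dest: spec[of _ n])
    then have "r * norm (x n) \<le> 2 * real m" by linarith
    then show ?thesis using \<open>0 < r\<close> by (simp add: field_simps)
  qed
  then show ?thesis by (rule BseqI')
qed

lemma limitin_weak_topology_imp_Bseq:
  fixes x :: "nat \<Rightarrow> 'a::real_normed_vector"
  assumes "limitin weak_topology x l sequentially"
  shows "Bseq x"
proof (rule pointwise_bounded_functionals_bounded)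
  fix \<phi> :: "'a \<Rightarrow>\<^sub>L real"
  have "convergent (\<lambda>n. blinfun_apply \<phi> (x n))"
    using assms unfolding limitin_weak_topology_iff convergent_def by blast
  then show "Bseq (\<lambda>n. blinfun_apply \<phi> (x n))" by (rule convergent_imp_Bseq)
qed

section \<open>The characterization\<close>

text \<open>The Schur property as defined yields some norm limit, not necessarily the weak limit \<open>l\<close>.
  Interleaving the sequence with the constant \<open>l\<close> preserves weak convergence and makes \<open>l\<close> the only
  possible norm limit.\<close>

lemma schur_property_weak_imp_norm:
  fixes x :: "nat \<Rightarrow> 'a::real_normed_vector"
  assumes schur: "schur_property TYPE('a)"
    and x: "limitin weak_topology x l sequentially"
  shows "x \<longlonglongrightarrow> l"
proof -
  define z where "z n = (if even n then x (n div 2) else l)" for n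
  have "limitin weak_topology z l sequentially"
    unfolding limitin_weak_topology_iff
  proof
    fix \<phi> :: "'a \<Rightarrow>\<^sub>L real"
    have "(\<lambda>n. blinfun_apply \<phi> (x n)) \<longlonglongrightarrow> blinfun_apply \<phi> l"
      using x limitin_weak_topology_iff by blast
    then have "(\<lambda>n. blinfun_apply \<phi> (x (n div 2))) \<longlonglongrightarrow> blinfun_apply \<phi> l"
      by (rule filterlim_compose) (rule filterlim_at_top_div_const_nat, simp)
    then have "\<forall>\<^sub>F n in sequentially. dist (blinfun_apply \<phi> (x (n div 2))) (blinfun_apply \<phi> l) < e"
      if "0 < e" for e
      using that by (rule tendstoD)
    then have "\<forall>\<^sub>F n in sequentially. dist (blinfun_apply \<phi> (z n)) (blinfun_apply \<phi> l) < e"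
      if "0 < e" for e
      by (rule eventually_mono) (use that in \<open>auto simp: z_def\<close>)
    then show "(\<lambda>n. blinfun_apply \<phi> (z n)) \<longlonglongrightarrow> blinfun_apply \<phi> l"
      by (rule tendstoI)
  qed
  then obtain l' where l': "z \<longlonglongrightarrow> l'"
    using schur unfolding schur_property_def convergent_def by blast
  have "(\<lambda>n. z (2 * n)) \<longlonglongrightarrow> l'" "(\<lambda>n. z (2 * n + 1)) \<longlonglongrightarrow> l'"
    using LIMSEQ_subseq_LIMSEQ[OF l', of "\<lambda>n. 2 * n"] LIMSEQ_subseq_LIMSEQ[OF l', of "\<lambda>n. 2 * n + 1"]
    by (auto simp: strict_mono_def o_def)
  then have "x \<longlonglongrightarrow> l'" "l' = l"
    by (simp_all add: z_def LIMSEQ_const_iff)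
  then show ?thesis by simp
qed

lemma schur_property_imp_seq_homeomorphic:
  assumes "schur_property TYPE('a::real_normed_vector)"
  shows "seq_homeomorphic_spaces (euclidean :: 'a topology) (weak_topology :: 'a topology)"
  unfolding seq_homeomorphic_spaces_def
proof (intro exI[of _ "id :: 'a \<Rightarrow> 'a"] conjI)
  have "inv_into UNIV (id :: 'a \<Rightarrow> 'a) = id" by (simp add: inv_id)
  then show "seq_continuous_map weak_topology euclidean (inv_into (topspace euclidean) (id :: 'a \<Rightarrow> 'a))"
    using schur_property_weak_imp_norm[OF assms] by (auto simp: seq_continuous_map_def)
  show "seq_continuous_map euclidean weak_topology (id :: 'a \<Rightarrow> 'a)"
    using limitin_weak_topology_if_tendsto by (auto simp: seq_continuous_map_def)
  show "bij_betw (id :: 'a \<Rightarrow> 'a) (topspace euclidean) (topspace weak_topology)"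
    by simp
qed

text \<open>The inverse of the homeomorphism maps all the sequences \<open>X n\<close> to norm convergent sequences with
  one limit. There the \<open>n\<close>-th term is picked within distance \<open>1 / (n + 1)\<close> of the limit, and the
  homeomorphism takes the result back. Since the picked index may be any sufficiently late one, it
  can also be made to satisfy a condition \<open>P n\<close> that holds for infinitely many indices.\<close>

lemma weak_diagonal_sequence:
  fixes X :: "nat \<Rightarrow> nat \<Rightarrow> 'a::real_normed_vector"
  assumes homeo: "seq_homeomorphic_spaces (euclidean :: 'a topology) (weak_topology :: 'a topology)"
    and X: "\<And>n. limitin weak_topology (X n) l sequentially"
    and P: "\<And>n. \<exists>\<^sub>F k in sequentially. P n k"
  obtains \<kappa> where "\<And>n. P n (\<kappa> n)" "limitin weak_topology (\<lambda>n. X n (\<kappa> n)) l sequentially"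
proof -
  obtain f :: "'a \<Rightarrow> 'a" where f: "bij f" "seq_continuous_map euclidean weak_topology f"
    "seq_continuous_map weak_topology euclidean (inv f)"
    using homeo unfolding seq_homeomorphic_spaces_def by auto
  have f_inv: "f (inv f a) = a" for a
    using f(1) by (simp add: bij_is_surj surj_f_inv_f)
  have "(inv f \<circ> X n) \<longlonglongrightarrow> inv f l" for n
    using f(3) X[of n] by (auto simp: seq_continuous_map_def)
  then have "\<forall>\<^sub>F k in sequentially. dist (inv f (X n k)) (inv f l) < inverse (real (Suc n))" for n
    using tendstoD[of "inv f \<circ> X n" "inv f l" sequentially "inverse (real (Suc n))"] by simp
  then have "\<exists>k. P n k \<and> dist (inv f (X n k)) (inv f l) < inverse (real (Suc n))" for n
    using frequently_ex[OF frequently_eventually_conj[OF P]] by blast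
  then obtain \<kappa> where \<kappa>: "\<And>n. P n (\<kappa> n)"
    "\<And>n. dist (inv f (X n (\<kappa> n))) (inv f l) < inverse (real (Suc n))"
    by metis
  have "(\<lambda>n. inv f (X n (\<kappa> n))) \<longlonglongrightarrow> inv f l"
    by (rule metric_tendsto_imp_tendsto[OF LIMSEQ_inverse_real_of_nat])
      (use \<kappa>(2) in \<open>auto intro!: always_eventually less_imp_le\<close>)
  then have "limitin weak_topology (f \<circ> (\<lambda>n. inv f (X n (\<kappa> n)))) (f (inv f l)) sequentially"
    using f(2) by (auto simp: seq_continuous_map_def)
  then have "limitin weak_topology (\<lambda>n. X n (\<kappa> n)) l sequentially"
    by (simp add: f_inv o_def)
  with \<kappa>(1) show ?thesis by (rule that)
qed

text \<open>A weakly convergent sequence that does not converge in norm to its weak limit yields, after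
  scaling the differences to this limit by \<open>n\<close> and passing to a diagonal, an unbounded weakly null
  sequence.\<close>

lemma seq_homeomorphic_imp_schur_property:
  assumes homeo: "seq_homeomorphic_spaces
    (euclidean :: 'a::real_normed_vector topology) (weak_topology :: 'a topology)"
  shows "schur_property TYPE('a)"
  unfolding schur_property_def
proof (intro allI impI)
  fix x :: "nat \<Rightarrow> 'a"
  assume "\<exists>l. limitin weak_topology x l sequentially"
  then obtain l where l: "limitin weak_topology x l sequentially" by blast
  have "x \<longlonglongrightarrow> l"
  proof (rule ccontr)
    assume "\<not> x \<longlonglongrightarrow> l"
    then obtain \<epsilon> where \<epsilon>: "0 < \<epsilon>" "\<exists>\<^sub>F k in sequentially. \<epsilon> \<le> norm (x k - l)"
      unfolding tendsto_iff by (auto simp: not_eventually dist_norm not_less)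
    define X where "X n k = real n *\<^sub>R (x k - l)" for n k
    have "limitin weak_topology (X n) 0 sequentially" for n
      unfolding limitin_weak_topology_iff
    proof
      fix \<phi> :: "'a \<Rightarrow>\<^sub>L real"
      have "(\<lambda>k. blinfun_apply \<phi> (x k)) \<longlonglongrightarrow> blinfun_apply \<phi> l"
        using l limitin_weak_topology_iff by blast
      then have "(\<lambda>k. real n * (blinfun_apply \<phi> (x k) - blinfun_apply \<phi> l))
              \<longlonglongrightarrow> real n * (blinfun_apply \<phi> l - blinfun_apply \<phi> l)"
        by (intro tendsto_mult tendsto_diff tendsto_const)
      then show "(\<lambda>k. blinfun_apply \<phi> (X n k)) \<longlonglongrightarrow> blinfun_apply \<phi> 0"
        by (simp add: X_def blinfun.bilinear_simps)
    qed
    then obtain \<kappa> where \<kappa>: "\<And>n. \<epsilon> \<le> norm (x (\<kappa> n) - l)"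
      and diagonal: "limitin weak_topology (\<lambda>n. X n (\<kappa> n)) 0 sequentially"
      using weak_diagonal_sequence[OF homeo, of X 0 "\<lambda>n k. \<epsilon> \<le> norm (x k - l)"] \<epsilon>(2) by blast
    obtain K where K: "\<And>n. norm (X n (\<kappa> n)) \<le> K"
      using limitin_weak_topology_imp_Bseq[OF diagonal] by (meson BseqE)
    have "real n * \<epsilon> \<le> K" for n
      using K[of n] mult_left_mono[OF \<kappa>[of n], of "real n"] by (simp add: X_def)
    then show False
      using reals_Archimedean3[OF \<epsilon>(1), rule_format, of K] by (meson not_less)
  qed
  then show "convergent x" by (rule convergentI)
qed

theorem theorem4p9:
  shows "schur_property TYPE('a::banach) \<longleftrightarrow>
         seq_homeomorphic_spaces (euclidean :: 'a topology) (weak_topology :: 'a topology)"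
  using schur_property_imp_seq_homeomorphic seq_homeomorphic_imp_schur_property by blast

end
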